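(* Let $\Phi:\mathbb{R}^n\to\mathbb{R}$ be convex and twice continuously differentiable, let $P:\mathbb{R}^n\to(-\infty,+\infty]$ be closed, proper and convex, and assume that the solution set of $\min_{x\in\mathbb{R}^n}\{\Phi(x)+P(x)\}$ is nonempty and compact. Let $I^0\subseteq[n]$, let $\epsilon\ge 0$, and let $k_{\max}$ be a positive integer. Then the while loop in the adaptive sieving algorithm (described in the context) with input $(I^0,\epsilon,k_{\max})$ terminates after a finite number of iterations; that is, in every run of the algorithm the stopping criterion $\|R(x^s)\|\le\epsilon$ is met at some finite $s\ge 0$.
   Context: Notation: $[n]=\{1,\dots,n\}$; for $I\subseteq[n]$, $\overline{I}=[n]\setminus I$; $x_I$ is the subvector of $x$ indexed by $I$; $\|\cdot\|$ is the Euclidean norm. For a closed proper convex function $q$, $\mathrm{Prox}_q(x)=\arg\min_{y}\{q(y)+\frac12\|y-x\|^2\}$. The proximal residual function is $R(x):=x-\mathrm{Prox}_P(x-\nabla\Phi(x))$, $x\in\mathbb{R}^n$. Adaptive sieving algorithm. Input: an initial index set $I^0\subseteq[n]$, a tolerance $\epsilon\ge0$, a positive integer $k_{\max}$. Step 1. Find $x^0\in\arg\min_{x\in\mathbb{R}^n}\{\Phi(x)+P(x)-\langle\delta^0,x\rangle \mid x_{\overline{I^0}}=0\}$, where $\delta^0\in\mathbb{R}^n$ is an error vector with $\|\delta^0\|\le\epsilon$ and $(\delta^0)_{\overline{I^0}}=0$. Step 2. Compute $R(x^0)$ and set $s=0$. While $\|R(x^s)\|>\epsilon$, do: (3.1)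 Set $J^{s+1}=\{j\in\overline{I^s}\mid (R(x^s))_j\ne0\}$. Let $\kappa$ be a positive integer with $\kappa\le\min\{|J^{s+1}|,k_{\max}\}$ (it may depend on $s$), let $\widehat{J}^{s+1}$ be the set of $j\in J^{s+1}$ such that $|(R(x^s))_j|$ is among the first $\kappa$ largest values in $\{|(R(x^s))_i|\}_{i\in J^{s+1}}$, and set $I^{s+1}=I^s\cup\widehat{J}^{s+1}$. (3.2) Find $x^{s+1}\in\arg\min_{x\in\mathbb{R}^n}\{\Phi(x)+P(x)-\langle\delta^{s+1},x\rangle \mid x_{\overline{I^{s+1}}}=0\}$ (starting the solver from $x^s$), where $\delta^{s+1}\in\mathbb{R}^n$ is an error vector with $\|\delta^{s+1}\|\le\epsilon$ and $(\delta^{s+1})_{\overline{I^{s+1}}}=0$. (3.3) Compute $R(x^{s+1})$ and set $s\leftarrow s+1$. Output: $x^*=x^s$ for the final $s$. The error vectors are not given a priori: they are any vectors satisfying the stated bounds, representing the inexactness with which the reduced problems are solved. It is understood that the reduced problems in Step 1 and (3.2) have minimizers with finite objective value and that $x^0$, $x^{s+1}$ are such minimizers. *)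

theory Defs
  imports "HOL-Analysis.Analysis" "HOL-Library.Extended_Nat"
begin

definition ext_epigraph :: "('a \<Rightarrow> ereal) \<Rightarrow> ('a \<times> real) set" where
  "ext_epigraph q = {(x, r). q x \<le> ereal r}"

definition proper_fun :: "('a \<Rightarrow> ereal) \<Rightarrow> bool" where
  "proper_fun q \<longleftrightarrow> (\<forall>x. q x \<noteq> -\<infinity>) \<and> (\<exists>x. q x \<noteq> \<infinity>)"

definition closed_fun :: "('a::topological_space \<Rightarrow> ereal) \<Rightarrow> bool" where
  "closed_fun q \<longleftrightarrow> closed (ext_epigraph q)"

definition convex_fun :: "('a::real_vector \<Rightarrow> ereal) \<Rightarrow> bool" where
  "convex_fun q \<longleftrightarrow> convex (ext_epigraph q)"

definition grad :: "('a::real_inner \<Rightarrow> real) \<Rightarrow> 'a \<Rightarrow> 'a" where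
  "grad f x = (THE g. GDERIV f x :> g)"

text \<open>Here \<open>g\<close> is the gradient and \<open>H\<close> the Hessian matrix.\<close>
definition twice_cont_diff :: "(real ^ 'n \<Rightarrow> real) \<Rightarrow> bool" where
  "twice_cont_diff f \<longleftrightarrow>
     (\<exists>g (H :: real ^ 'n \<Rightarrow> real ^ 'n ^ 'n).
        (\<forall>x. GDERIV f x :> g x) \<and>
        (\<forall>x. (g has_derivative (\<lambda>h. H x *v h)) (at x)) \<and>
        continuous_on UNIV H)"

text \<open>The minimizer is unique when \<open>q\<close> is closed, proper and convex.\<close>
definition prox :: "('a::real_normed_vector \<Rightarrow> ereal) \<Rightarrow> 'a \<Rightarrow> 'a" where
  "prox q x = arg_min (\<lambda>y. q y + ereal ((norm (y - x))\<^sup>2 / 2)) (\<lambda>_. True)"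

definition prox_residual ::
  "(real ^ 'n \<Rightarrow> real) \<Rightarrow> (real ^ 'n \<Rightarrow> ereal) \<Rightarrow> real ^ 'n \<Rightarrow> real ^ 'n" where
  "prox_residual \<Phi> P x = x - prox P (x - grad \<Phi> x)"

definition solution_set :: "(real ^ 'n \<Rightarrow> real) \<Rightarrow> (real ^ 'n \<Rightarrow> ereal) \<Rightarrow> (real ^ 'n) set" where
  "solution_set \<Phi> P = {x. is_arg_min (\<lambda>z. ereal (\<Phi> z) + P z) (\<lambda>_. True) x}"

definition reduced_objective ::
  "(real ^ 'n \<Rightarrow> real) \<Rightarrow> (real ^ 'n \<Rightarrow> ereal) \<Rightarrow> real ^ 'n \<Rightarrow> real ^ 'n \<Rightarrow> ereal" where
  "reduced_objective \<Phi> P \<delta> z = ereal (\<Phi> z) + P z - ereal (\<delta> \<bullet> z)"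

definition reduced_solution ::
  "(real ^ 'n \<Rightarrow> real) \<Rightarrow> (real ^ 'n \<Rightarrow> ereal) \<Rightarrow> real \<Rightarrow> 'n set \<Rightarrow> real ^ 'n \<Rightarrow> real ^ 'n \<Rightarrow> bool" where
  "reduced_solution \<Phi> P \<epsilon> I \<delta> x \<longleftrightarrow>
     norm \<delta> \<le> \<epsilon> \<and> (\<forall>i. i \<notin> I \<longrightarrow> \<delta> $ i = 0) \<and>
     is_arg_min (reduced_objective \<Phi> P \<delta>) (\<lambda>z. \<forall>i. i \<notin> I \<longrightarrow> z $ i = 0) x \<and>
     \<bar>reduced_objective \<Phi> P \<delta> x\<bar> \<noteq> \<infinity>"

definition violated ::
  "(real ^ 'n \<Rightarrow> real) \<Rightarrow> (real ^ 'n \<Rightarrow> ereal) \<Rightarrow> 'n set \<Rightarrow> real ^ 'n \<Rightarrow> 'n set" where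
  "violated \<Phi> P I x = {j. j \<notin> I \<and> prox_residual \<Phi> P x $ j \<noteq> 0}"

text \<open>
  \<open>S\<close> consists of the indices in \<open>J\<close> whose \<open>v\<close>-values are among the \<open>k\<close> largest. If \<open>v\<close> is
  injective on \<open>J\<close> and \<open>k \<le> card J\<close>, this determines \<open>S\<close>, and \<open>card S = k\<close>. With ties, every
  usual convention is admitted: exactly \<open>k\<close> indices with ties broken arbitrarily, all indices
  whose value is at least the \<open>k\<close>-th largest counted with multiplicity, or all indices whose
  value is one of the \<open>k\<close> largest distinct values.
\<close>
definition largest_selection :: "('i \<Rightarrow> real) \<Rightarrow> 'i set \<Rightarrow> nat \<Rightarrow> 'i set \<Rightarrow> bool" where
  "largest_selection v J k S \<longleftrightarrow>
     S \<subseteq> J \<and> k \<le> card S \<and>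
     (\<forall>j\<in>S. \<forall>i\<in>J - S. v i \<le> v j) \<and>
     (\<forall>j\<in>S. card {r \<in> v ` J. v j < r} < k)"

definition sieve_update ::
  "(real ^ 'n \<Rightarrow> real) \<Rightarrow> (real ^ 'n \<Rightarrow> ereal) \<Rightarrow> nat \<Rightarrow> 'n set \<Rightarrow> real ^ 'n \<Rightarrow> 'n set \<Rightarrow> bool" where
  "sieve_update \<Phi> P kmax I x I' \<longleftrightarrow>
     (\<exists>\<kappa> S. 0 < \<kappa> \<and> \<kappa> \<le> min (card (violated \<Phi> P I x)) kmax \<and>
        largest_selection (\<lambda>i. \<bar>prox_residual \<Phi> P x $ i\<bar>) (violated \<Phi> P I x) \<kappa> S \<and>
        I' = I \<union> S)"

text \<open>
  A run performs \<open>N\<close> loop iterations, possibly infinitely many; \<open>I s\<close>, \<open>\<delta> s\<close>, \<open>x s\<close> are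
  meaningful for \<open>s \<le> N\<close> only. A finite run ends either because the stopping criterion holds or
  because the loop body gets stuck: no admissible \<open>\<kappa>\<close>, hence no new index set, exists.
  Reduced problems are taken to be solvable, so they are not a reason for a run to end.
\<close>
definition sieving_run ::
  "(real ^ 'n \<Rightarrow> real) \<Rightarrow> (real ^ 'n \<Rightarrow> ereal) \<Rightarrow> 'n set \<Rightarrow> real \<Rightarrow> nat \<Rightarrow>
   enat \<Rightarrow> (nat \<Rightarrow> 'n set) \<Rightarrow> (nat \<Rightarrow> real ^ 'n) \<Rightarrow> (nat \<Rightarrow> real ^ 'n) \<Rightarrow> bool" where
  "sieving_run \<Phi> P I0 \<epsilon> kmax N I \<delta> x \<longleftrightarrow>
     I 0 = I0 \<and> reduced_solution \<Phi> P \<epsilon> (I 0) (\<delta> 0) (x 0) \<and>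
     (\<forall>s. enat s < N \<longrightarrow>
        norm (prox_residual \<Phi> P (x s)) > \<epsilon> \<and>
        sieve_update \<Phi> P kmax (I s) (x s) (I (Suc s)) \<and>
        reduced_solution \<Phi> P \<epsilon> (I (Suc s)) (\<delta> (Suc s)) (x (Suc s))) \<and>
     (\<forall>s. N = enat s \<longrightarrow>
        norm (prox_residual \<Phi> P (x s)) \<le> \<epsilon> \<or>
        \<not> (\<exists>I'. sieve_update \<Phi> P kmax (I s) (x s) I'))"

end

theory Submission
  imports Defs
begin

text \<open>
  Every index that the loop adds lies outside the current index set, so the index sets of a run
  increase strictly and a run performs at most as many iterations as there are indices. What has to
  be shown is that a run cannot get stuck: while the stopping criterion fails, the set of violated
  indices must be nonempty.

  Suppose that no index outside \<open>I\<close> is violated at a solution \<open>x\<close> of the problem reduced to \<open>I\<close>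
  with error vector \<open>\<delta>\<close>. Write \<open>g\<close> for the gradient of \<open>\<Phi>\<close> at \<open>x\<close>, \<open>R\<close> for the residual at \<open>x\<close>,
  and \<open>u = x - R\<close> for the proximal point. As \<open>R\<close> vanishes outside \<open>I\<close>, the point \<open>u\<close> is feasible
  for the reduced problem. The first-order condition for \<open>x\<close>, tested at \<open>u\<close>, and the one for \<open>u\<close>,
  tested at \<open>x\<close>, read
  \<open>P x \<le> P u + (g - \<delta>) \<bullet> (u - x)\<close> and \<open>P u \<le> P x + (u - (x - g)) \<bullet> (x - u)\<close>.
  Their sum is \<open>R \<bullet> R \<le> \<delta> \<bullet> R\<close>, and \<open>norm R \<le> norm \<delta> \<le> \<epsilon>\<close> follows by Cauchy--Schwarz. This
  is \<open>norm_prox_residual_le_if_none_violated\<close>.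

  Both first-order conditions are instances of \<open>smooth_plus_epigraph_first_order\<close>. They compare
  values of \<open>P\<close> on the subspace instead of splitting a subgradient of \<open>P\<close> plus the indicator of
  the subspace, for which a constraint qualification would have to hold. The
  proximal point exists because \<open>P\<close> has an affine minorant, which is the same first-order condition
  once more, at a minimizer of \<open>\<Phi> + P\<close>.
\<close>

section \<open>First-order conditions on the epigraph\<close>

text \<open>
  Minimizing \<open>f + P\<close> over a set amounts to minimizing \<open>f y + r\<close> over the part of the epigraph of
  \<open>P\<close> above that set. In this form infinite values never appear, and a constraint is just an
  intersection of convex sets. Along the segment from \<open>(u, p)\<close> to \<open>(z, r)\<close> the second coordinate
  is affine, so the inequality is the sign of the one-sided derivative at the minimum.
\<close>
lemma smooth_plus_epigraph_first_order:
  fixes f :: "'a::real_inner \<Rightarrow> real"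
  assumes deriv: "GDERIV f u :> g"
    and conv: "convex C" and u: "(u, p) \<in> C" and z: "(z, r) \<in> C"
    and min: "\<And>y s. (y, s) \<in> C \<Longrightarrow> f u + p \<le> f y + s"
  shows "p \<le> r + g \<bullet> (z - u)"
proof -
  define h where "h t = f (u + t *\<^sub>R (z - u)) + t * (r - p)" for t
  have "((\<lambda>t. u + t *\<^sub>R (z - u)) has_derivative (\<lambda>t. t *\<^sub>R (z - u))) (at 0)"
    by (auto intro!: derivative_eq_intros)
  moreover have "(f has_derivative (\<lambda>v. v \<bullet> g)) (at (u + 0 *\<^sub>R (z - u)))"
    using deriv by (simp add: gderiv_def)
  ultimately have "((\<lambda>t. f (u + t *\<^sub>R (z - u))) has_derivative (\<lambda>t. (t *\<^sub>R (z - u)) \<bullet> g)) (at 0)"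
    by (rule has_derivative_compose)
  then have "(h has_derivative (\<lambda>t. (t *\<^sub>R (z - u)) \<bullet> g + t * (r - p))) (at 0)"
    unfolding h_def by (intro derivative_eq_intros) auto
  then have deriv_h: "(h has_real_derivative (g \<bullet> (z - u) + (r - p))) (at 0)"
    unfolding has_field_derivative_def
    by (rule has_derivative_eq_rhs) (auto simp: inner_commute algebra_simps)
  have h_ge: "h 0 \<le> h t" if "0 < t" "t \<le> 1" for t
  proof -
    have "(1 - t) *\<^sub>R (u, p) + t *\<^sub>R (z, r) \<in> C"
      using convexD_alt[OF conv u z, of t] that by simp
    then have "(u + t *\<^sub>R (z - u), p + t * (r - p)) \<in> C"
      by (simp add: algebra_simps)
    from min[OF this] show ?thesis by (simp add: h_def)
  qed
  have "0 \<le> g \<bullet> (z - u) + (r - p)"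
  proof (rule ccontr)
    assume "\<not> ?thesis"
    then obtain d where d: "d > 0" "\<forall>t>0. t < d \<longrightarrow> h (0 + t) < h 0"
      using DERIV_neg_dec_right[OF deriv_h] by auto
    have "h (min 1 (d / 2)) < h 0" using d by (auto simp: min_def)
    moreover have "h 0 \<le> h (min 1 (d / 2))" using d by (intro h_ge) auto
    ultimately show False by simp
  qed
  then show ?thesis by simp
qed

lemma is_arg_min_plus_epigraph:
  assumes "is_arg_min (\<lambda>z. ereal (f z) + P z) Q u" and "P u = ereal p"
    and "(y, s) \<in> ext_epigraph P" and "Q y"
  shows "f u + p \<le> f y + s"
proof -
  have "ereal (f u) + P u \<le> ereal (f y) + P y"
    using assms(1,4) by (auto simp: is_arg_min_def not_less)
  also have "\<dots> \<le> ereal (f y) + ereal s"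
    using assms(3) by (intro add_left_mono) (simp add: ext_epigraph_def)
  finally show ?thesis using assms(2) by simp
qed

section \<open>The proximal point\<close>

lemma half_square_dist_gderiv: "GDERIV (\<lambda>y. (norm (y - w))\<^sup>2 / 2) u :> (u - w)"
proof -
  have "((\<lambda>y. ((y - w) \<bullet> (y - w)) / 2) has_derivative (\<lambda>h. h \<bullet> (u - w))) (at u)"
    by (auto intro!: derivative_eq_intros simp: inner_commute)
  then show ?thesis by (simp add: gderiv_def power2_norm_eq_inner)
qed

text \<open>
  Under the affine minorant \<open>a + b \<bullet> y\<close>, completing the square confines the first coordinate of
  every epigraph point below a given level to a ball around \<open>w - b\<close>, and then the second coordinate
  is bounded as well. Hence sublevel sets on the epigraph are compact.
\<close>
lemma epigraph_half_square_dist_attains_min: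
  fixes C :: "('a::euclidean_space \<times> real) set"
  assumes "closed C" and "(y0, r0) \<in> C"
    and minorant: "\<And>y r. (y, r) \<in> C \<Longrightarrow> a + b \<bullet> y \<le> r"
  obtains u p where "(u, p) \<in> C"
    and "\<And>y r. (y, r) \<in> C \<Longrightarrow> p + (norm (u - w))\<^sup>2 / 2 \<le> r + (norm (y - w))\<^sup>2 / 2"
proof -
  define \<phi> :: "'a \<times> real \<Rightarrow> real" where "\<phi> = (\<lambda>c. snd c + (norm (fst c - w))\<^sup>2 / 2)"
  define K where "K = \<phi> (y0, r0)"
  define D where "D = C \<inter> {c. \<phi> c \<le> K}"
  have cont: "continuous_on UNIV \<phi>"
    unfolding \<phi>_def by (intro continuous_intros) auto
  have "closed D"
    unfolding D_def using \<open>closed C\<close> by (intro closed_Int closed_Collect_le cont) auto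
  moreover have "bounded D"
  proof -
    define M where "M = sqrt (2 * (K - a - b \<bullet> w) + (norm b)\<^sup>2)"
    define B where "B = M + norm (w - b)"
    have "norm y \<le> B \<and> a - norm b * B \<le> r \<and> r \<le> K" if "(y, r) \<in> D" for y r
    proof -
      have r_le: "r + (norm (y - w))\<^sup>2 / 2 \<le> K" and r_ge: "a + b \<bullet> y \<le> r"
        using that minorant by (auto simp: D_def \<phi>_def)
      have "(norm (y - (w - b)))\<^sup>2 = (norm (y - w))\<^sup>2 + 2 * (b \<bullet> y - b \<bullet> w) + (norm b)\<^sup>2"
        by (simp add: power2_norm_eq_inner algebra_simps inner_commute)
      also have "\<dots> \<le> 2 * (K - a - b \<bullet> w) + (norm b)\<^sup>2"
        using r_le r_ge by (simp add: field_simps)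
      finally have "norm (y - (w - b)) \<le> M"
        unfolding M_def by (rule real_le_rsqrt)
      then have y: "norm y \<le> B"
        unfolding B_def using norm_triangle_sub[of y "w - b"] by simp
      have "- (b \<bullet> y) \<le> norm b * norm y"
        using Cauchy_Schwarz_ineq2[of b y] by simp
      also have "\<dots> \<le> norm b * B" using y by (intro mult_left_mono) auto
      finally have "a - norm b * B \<le> r" using r_ge by simp
      moreover have "r \<le> K" using r_le zero_le_power2[of "norm (y - w)"] by linarith
      ultimately show ?thesis using y by blast
    qed
    then have "D \<subseteq> cball 0 B \<times> {a - norm b * B..K}" by auto
    then show ?thesis
      by (rule bounded_subset[rotated]) (intro bounded_Times bounded_cball bounded_closed_interval)
  qed
  ultimately have "compact D" by (simp add: compact_eq_bounded_closed)
  moreover have "D \<noteq> {}" using assms(2) by (auto simp: D_def K_def)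
  ultimately obtain c where c: "c \<in> D" "\<forall>d\<in>D. \<phi> c \<le> \<phi> d"
    using continuous_attains_inf[of D \<phi>] continuous_on_subset[OF cont] by blast
  have "\<phi> c \<le> \<phi> d" if "d \<in> C" for d
  proof (cases "\<phi> d \<le> K")
    case True
    with c that show ?thesis by (simp add: D_def)
  next
    case False
    with c show ?thesis by (simp add: D_def)
  qed
  then show thesis
    using that[of "fst c" "snd c"] c(1) by (auto simp: D_def \<phi>_def)
qed

lemma prox_is_arg_min:
  fixes P :: "'a::euclidean_space \<Rightarrow> ereal"
  assumes closed: "closed_fun P" and proper: "proper_fun P"
    and minorant: "\<And>y r. (y, r) \<in> ext_epigraph P \<Longrightarrow> a + b \<bullet> y \<le> r"
  shows "is_arg_min (\<lambda>y. P y + ereal ((norm (y - w))\<^sup>2 / 2)) (\<lambda>_. True) (prox P w)"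
proof -
  obtain y0 where y0: "P y0 \<noteq> \<infinity>" "P y0 \<noteq> -\<infinity>"
    using proper by (auto simp: proper_fun_def)
  then have "(y0, real_of_ereal (P y0)) \<in> ext_epigraph P"
    by (auto simp: ext_epigraph_def ereal_real)
  with closed obtain u p where u: "(u, p) \<in> ext_epigraph P"
    and min: "\<And>y r. (y, r) \<in> ext_epigraph P \<Longrightarrow>
      p + (norm (u - w))\<^sup>2 / 2 \<le> r + (norm (y - w))\<^sup>2 / 2"
    using epigraph_half_square_dist_attains_min[OF _ _ minorant, of "ext_epigraph P"]
    unfolding closed_fun_def by metis
  have "P u + ereal ((norm (u - w))\<^sup>2 / 2) \<le> P y + ereal ((norm (y - w))\<^sup>2 / 2)" for y
  proof (cases "P y")
    case (real r)
    have "P u + ereal ((norm (u - w))\<^sup>2 / 2) \<le> ereal p + ereal ((norm (u - w))\<^sup>2 / 2)"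
      using u by (intro add_right_mono) (simp add: ext_epigraph_def)
    also have "\<dots> \<le> P y + ereal ((norm (y - w))\<^sup>2 / 2)"
      using min[of y r] real by (simp add: ext_epigraph_def)
    finally show ?thesis .
  next
    case MInf
    with proper show ?thesis by (simp add: proper_fun_def)
  qed simp
  then have "is_arg_min (\<lambda>y. P y + ereal ((norm (y - w))\<^sup>2 / 2)) (\<lambda>_. True) u"
    by (simp add: is_arg_min_def not_less)
  then show ?thesis
    unfolding prox_def arg_min_def by (rule someI)
qed

lemma prox_first_order:
  fixes P :: "'a::euclidean_space \<Rightarrow> ereal"
  assumes "closed_fun P" and "proper_fun P" and "convex_fun P"
    and "\<And>y r. (y, r) \<in> ext_epigraph P \<Longrightarrow> a + b \<bullet> y \<le> r"
  obtains p where "P (prox P w) = ereal p"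
    and "\<And>z r. (z, r) \<in> ext_epigraph P \<Longrightarrow> p \<le> r + (prox P w - w) \<bullet> (z - prox P w)"
proof -
  let ?u = "prox P w" and ?f = "\<lambda>y. (norm (y - w))\<^sup>2 / 2"
  have min: "is_arg_min (\<lambda>y. ereal (?f y) + P y) (\<lambda>_. True) ?u"
    using prox_is_arg_min[OF assms(1,2,4), of w] by (simp add: add.commute)
  obtain y0 where y0: "P y0 \<noteq> \<infinity>"
    using assms(2) by (auto simp: proper_fun_def)
  have "ereal (?f ?u) + P ?u \<le> ereal (?f y0) + P y0"
    using min by (simp add: is_arg_min_linorder)
  then have "P ?u \<noteq> \<infinity>" using y0 by auto
  then obtain p where p: "P ?u = ereal p"
    using assms(2) by (cases "P ?u") (auto simp: proper_fun_def)
  have "p \<le> r + (?u - w) \<bullet> (z - ?u)" if "(z, r) \<in> ext_epigraph P" for z r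
    using is_arg_min_plus_epigraph[OF min p] assms(3) p that
    by (intro smooth_plus_epigraph_first_order[OF half_square_dist_gderiv, of "ext_epigraph P"])
      (auto simp: convex_fun_def ext_epigraph_def)
  with p show thesis by (rule that)
qed

section \<open>Solutions of reduced problems\<close>

lemma twice_cont_diff_gderiv_grad:
  assumes "twice_cont_diff \<Phi>"
  shows "GDERIV \<Phi> x :> grad \<Phi> x"
proof -
  obtain g where "GDERIV \<Phi> x :> g"
    using assms by (auto simp: twice_cont_diff_def)
  moreover have "h = g" if "GDERIV \<Phi> x :> h" "GDERIV \<Phi> x :> g" for h g
  proof -
    have "(\<lambda>v. v \<bullet> h) = (\<lambda>v. v \<bullet> g)"
      using that unfolding gderiv_def by (rule has_derivative_unique)
    then have "\<forall>v. v \<bullet> h = v \<bullet> g" by (simp add: fun_eq_iff)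
    then show ?thesis by (rule vector_eq_ldot[THEN iffD1])
  qed
  ultimately show ?thesis
    unfolding grad_def by (metis (mono_tags, lifting) theI)
qed

lemma solution_affine_minorant:
  assumes deriv: "GDERIV \<Phi> z :> g" and proper: "proper_fun P" and conv: "convex_fun P"
    and sol: "z \<in> solution_set \<Phi> P"
  obtains a b where "\<And>y r. (y, r) \<in> ext_epigraph P \<Longrightarrow> a + b \<bullet> y \<le> r"
proof -
  have min: "is_arg_min (\<lambda>z. ereal (\<Phi> z) + P z) (\<lambda>_. True) z"
    using sol by (simp add: solution_set_def)
  obtain y0 where y0: "P y0 \<noteq> \<infinity>"
    using proper by (auto simp: proper_fun_def)
  have "ereal (\<Phi> z) + P z \<le> ereal (\<Phi> y0) + P y0"
    using min by (simp add: is_arg_min_linorder)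
  then have "P z \<noteq> \<infinity>" using y0 by auto
  then obtain p where p: "P z = ereal p"
    using proper by (cases "P z") (auto simp: proper_fun_def)
  have "p \<le> r + g \<bullet> (y - z)" if "(y, r) \<in> ext_epigraph P" for y r
    using is_arg_min_plus_epigraph[OF min p] conv p that
    by (intro smooth_plus_epigraph_first_order[OF deriv, of "ext_epigraph P"])
      (auto simp: convex_fun_def ext_epigraph_def)
  then have "(p + g \<bullet> z) + (- g) \<bullet> y \<le> r" if "(y, r) \<in> ext_epigraph P" for y r
    using that by (fastforce simp: inner_diff_right)
  then show thesis by (rule that)
qed

text \<open>
  The feasible points are the elements of a linear subspace, so the part of the epigraph above them
  is convex; the linear error term is absorbed into the smooth part, whose gradient becomes
  \<open>g - \<delta>\<close>.
\<close>
lemma reduced_solution_first_order: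
  fixes P :: "real ^ 'n \<Rightarrow> ereal"
  assumes deriv: "GDERIV \<Phi> x :> g" and conv: "convex_fun P"
    and sol: "reduced_solution \<Phi> P \<epsilon> I \<delta> x"
  obtains p where "P x = ereal p"
    and "\<And>z r. (z, r) \<in> ext_epigraph P \<Longrightarrow> \<forall>i. i \<notin> I \<longrightarrow> z $ i = 0 \<Longrightarrow>
      p \<le> r + (g - \<delta>) \<bullet> (z - x)"
proof -
  let ?Q = "\<lambda>z. \<forall>i. i \<notin> I \<longrightarrow> z $ i = 0"
  define f where "f z = \<Phi> z - \<delta> \<bullet> z" for z
  define C where "C = ext_epigraph P \<inter> ({z. ?Q z} \<times> UNIV)"
  have obj: "reduced_objective \<Phi> P \<delta> = (\<lambda>z. ereal (f z) + P z)"
  proof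
    fix z show "reduced_objective \<Phi> P \<delta> z = ereal (f z) + P z"
      by (cases "P z") (auto simp: reduced_objective_def f_def)
  qed
  have min: "is_arg_min (\<lambda>z. ereal (f z) + P z) ?Q x"
    using sol unfolding reduced_solution_def obj by blast
  obtain p where p: "P x = ereal p"
    using sol unfolding reduced_solution_def obj by (cases "P x") auto
  have "GDERIV f x :> g - \<delta>"
    using deriv unfolding gderiv_def f_def
    by (auto intro!: derivative_eq_intros simp: inner_diff_right inner_commute)
  moreover have "convex {z :: real ^ 'n. ?Q z}"
    by (auto simp: convex_def)
  with conv have "convex C"
    unfolding C_def convex_fun_def by (intro convex_Int convex_Times) auto
  moreover have x: "(x, p) \<in> C"
    using p min by (auto simp: C_def ext_epigraph_def is_arg_min_def)
  moreover have "f x + p \<le> f y + s" if "(y, s) \<in> C" for y s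
    using that is_arg_min_plus_epigraph[OF min p] by (auto simp: C_def)
  ultimately have "p \<le> r + (g - \<delta>) \<bullet> (z - x)" if "(z, r) \<in> C" for z r
    using that by (blast intro: smooth_plus_epigraph_first_order)
  then show thesis
    by (intro that[OF p]) (auto simp: C_def)
qed

text \<open>
  The first-order conditions of \<open>x\<close> and of its proximal point can be tested at each other, since
  both points are feasible for the reduced problem; the gradient and the values of \<open>P\<close> cancel in
  the sum.
\<close>
lemma norm_prox_residual_le_if_none_violated:
  fixes P :: "real ^ 'n \<Rightarrow> ereal"
  assumes smooth: "twice_cont_diff \<Phi>"
    and closed: "closed_fun P" and proper: "proper_fun P" and conv: "convex_fun P"
    and solvable: "solution_set \<Phi> P \<noteq> {}"
    and sol: "reduced_solution \<Phi> P \<epsilon> I \<delta> x"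
    and none: "violated \<Phi> P I x = {}"
  shows "norm (prox_residual \<Phi> P x) \<le> \<epsilon>"
proof -
  define g where "g = grad \<Phi> x"
  define u where "u = prox P (x - g)"
  define R where "R = x - u"
  have R_eq: "R = prox_residual \<Phi> P x"
    by (simp add: R_def u_def g_def prox_residual_def)
  obtain a b where "\<And>y r. (y, r) \<in> ext_epigraph P \<Longrightarrow> a + b \<bullet> y \<le> r"
    using solvable solution_affine_minorant[OF twice_cont_diff_gderiv_grad[OF smooth] proper conv]
    by blast
  from prox_first_order[OF closed proper conv this, of "x - g"]
  obtain q where q: "P u = ereal q"
    and fo_u: "\<And>z r. (z, r) \<in> ext_epigraph P \<Longrightarrow> q \<le> r + (u - (x - g)) \<bullet> (z - u)"
    unfolding u_def by blast
  obtain p where p: "P x = ereal p"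
    and fo_x: "\<And>z r. (z, r) \<in> ext_epigraph P \<Longrightarrow> \<forall>i. i \<notin> I \<longrightarrow> z $ i = 0 \<Longrightarrow>
      p \<le> r + (g - \<delta>) \<bullet> (z - x)"
    using reduced_solution_first_order[OF twice_cont_diff_gderiv_grad[OF smooth] conv sol]
    unfolding g_def by blast
  have "u $ i = 0" if "i \<notin> I" for i
  proof -
    have "x $ i = 0"
      using sol that by (auto simp: reduced_solution_def is_arg_min_def)
    moreover have "R $ i = 0"
      using none that by (auto simp: violated_def R_eq)
    ultimately show ?thesis by (simp add: R_def)
  qed
  then have "p \<le> q + (g - \<delta>) \<bullet> (u - x)"
    using q by (intro fo_x) (auto simp: ext_epigraph_def)
  moreover have "q \<le> p + (u - (x - g)) \<bullet> (x - u)"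
    using p by (intro fo_u) (auto simp: ext_epigraph_def)
  ultimately have "R \<bullet> R \<le> \<delta> \<bullet> R"
    by (simp add: R_def algebra_simps inner_commute)
  also have "\<dots> \<le> norm \<delta> * norm R" by (rule norm_cauchy_schwarz)
  also have "\<dots> \<le> \<epsilon> * norm R"
    using sol by (intro mult_right_mono) (auto simp: reduced_solution_def)
  finally have "norm R * norm R \<le> \<epsilon> * norm R"
    by (simp add: power2_norm_eq_inner[symmetric] power2_eq_square)
  moreover have "0 \<le> \<epsilon>"
    using sol norm_ge_zero[of \<delta>] unfolding reduced_solution_def by linarith
  ultimately have "norm R \<le> \<epsilon>"
    by (cases "R = 0") auto
  then show ?thesis by (simp add: R_eq)
qed

section \<open>Runs of the algorithm\<close>

lemma sieve_update_psubset:
  assumes "sieve_update \<Phi> P kmax I x I'"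
  shows "I \<subset> I'"
proof -
  obtain k S where S: "0 < k" "k \<le> card S" "S \<subseteq> violated \<Phi> P I x" "I' = I \<union> S"
    using assms by (auto simp: sieve_update_def largest_selection_def)
  then have "S \<noteq> {}" by auto
  with S(3,4) show ?thesis by (auto simp: violated_def)
qed

text \<open>Selecting one index with the largest residual, with \<open>\<kappa> = 1\<close>, is always admissible.\<close>
lemma sieve_update_exists_if_violated:
  assumes "violated \<Phi> P I x \<noteq> {}" and "0 < kmax"
  shows "\<exists>I'. sieve_update \<Phi> P kmax I x I'"
proof -
  let ?J = "violated \<Phi> P I x" and ?v = "\<lambda>i. \<bar>prox_residual \<Phi> P x $ i\<bar>"
  have "Max (?v ` ?J) \<in> ?v ` ?J" using assms by (intro Max_in) auto
  then obtain j where j: "j \<in> ?J" "?v j = Max (?v ` ?J)" by auto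
  have max: "?v i \<le> ?v j" if "i \<in> ?J" for i
    unfolding j(2) using that by (intro Max_ge) auto
  then have "{r \<in> ?v ` ?J. ?v j < r} = {}" by (auto simp: not_less)
  then have "largest_selection ?v ?J 1 {j}"
    using j max by (simp add: largest_selection_def)
  moreover have "1 \<le> min (card ?J) kmax"
    using assms by (simp add: Suc_le_eq card_gt_0_iff)
  ultimately show ?thesis
    unfolding sieve_update_def by (intro exI[of _ "I \<union> {j}"] exI[of _ 1] exI[of _ "{j}"]) auto
qed

lemma sieving_run_reduced_solution:
  assumes "sieving_run \<Phi> P I0 \<epsilon> kmax N I \<delta> x" and "enat s \<le> N"
  shows "reduced_solution \<Phi> P \<epsilon> (I s) (\<delta> s) (x s)"
proof (cases s)
  case 0
  with assms show ?thesis by (auto simp: sieving_run_def)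
next
  case (Suc t)
  then have "enat t < N"
    using assms(2) by (cases N) auto
  with assms(1) Suc show ?thesis by (simp add: sieving_run_def)
qed

lemma sieving_run_finite:
  fixes I :: "nat \<Rightarrow> 'n::finite set"
  assumes "sieving_run \<Phi> P I0 \<epsilon> kmax N I \<delta> x"
  obtains s where "N = enat s"
proof (cases N)
  case infinity
  have grow: "I s \<subset> I (Suc s)" for s
    using assms infinity
    by (intro sieve_update_psubset[of \<Phi> P kmax _ "x s"]) (simp add: sieving_run_def)
  have "s \<le> card (I s)" for s
  proof (induction s)
    case (Suc s)
    then show ?case using psubset_card_mono[OF finite grow[of s]] by simp
  qed simp
  from this[of "Suc CARD('n)"] card_mono[OF finite subset_UNIV, of "I (Suc CARD('n))"]
  show ?thesis by simp
qed (use that in auto)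

theorem theorem1:
  fixes \<Phi> :: "real ^ 'n \<Rightarrow> real"
    and P :: "real ^ 'n \<Rightarrow> ereal"
    and I0 :: "'n set" and \<epsilon> :: real and kmax :: nat
    and N :: enat and I :: "nat \<Rightarrow> 'n set" and \<delta> x :: "nat \<Rightarrow> real ^ 'n"
  assumes "convex_on UNIV \<Phi>" and "twice_cont_diff \<Phi>"
    and "closed_fun P" and "proper_fun P" and "convex_fun P"
    and "solution_set \<Phi> P \<noteq> {}" and "compact (solution_set \<Phi> P)"
    and "0 \<le> \<epsilon>" and "0 < kmax"
    and "sieving_run \<Phi> P I0 \<epsilon> kmax N I \<delta> x"
  shows "\<exists>s. N = enat s \<and> norm (prox_residual \<Phi> P (x s)) \<le> \<epsilon>"
proof -
  obtain s where N: "N = enat s"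
    using sieving_run_finite[OF assms(10)] .
  then have "norm (prox_residual \<Phi> P (x s)) \<le> \<epsilon> \<or> \<not> (\<exists>I'. sieve_update \<Phi> P kmax (I s) (x s) I')"
    using assms(10) by (simp add: sieving_run_def)
  then have "norm (prox_residual \<Phi> P (x s)) \<le> \<epsilon>"
  proof
    assume "\<not> (\<exists>I'. sieve_update \<Phi> P kmax (I s) (x s) I')"
    then have "violated \<Phi> P (I s) (x s) = {}"
      using sieve_update_exists_if_violated[OF _ assms(9)] by blast
    moreover have "reduced_solution \<Phi> P \<epsilon> (I s) (\<delta> s) (x s)"
      using sieving_run_reduced_solution[OF assms(10)] N by simp
    ultimately show ?thesis
      using norm_prox_residual_le_if_none_violated assms(2-6) by blast
  qed
  with N show ?thesis by blast
qed

end
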